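(* Let $A$ be a finite set and let $\{I_i\},\{J_j\},\{K_k\}\in\mathcal{P}^2_{dis}(A)$ be such that the supports $\mathcal{R}(\{I_i\})$, $\mathcal{R}(\{J_j\})$, $\mathcal{R}(\{K_k\})$ are pairwise disjoint. Then the bracket $[X,Y]=X\circ Y-Y\circ X$ satisfies the Jacobi identity $$[\{I_i\},[\{J_j\},\{K_k\}]]+[\{K_k\},[\{I_i\},\{J_j\}]]+[\{J_j\},[\{K_k\},\{I_i\}]]=0 .$$
   Context: $\mathcal{P}^2_{dis}(A)$ is the set of families $\{I_i\}=\{I_1,\dots,I_m\}$ of pairwise disjoint nonempty subsets (blocks) of the finite set $A$; the order of the blocks is ignored. The support is $\mathcal{R}(\{I_i\})=\bigcup_i I_i$. $\mathbb{K}$ is a field of characteristic zero and $\mathbb{K}(\mathcal{P}^2_{dis}(A))$ is the $\mathbb{K}$-vector space with basis $\mathcal{P}^2_{dis}(A)$. Insertion: for $\{I_i\},\{J_j\}_{j=1}^n$ with disjoint supports, a block $I_a$, and a map $\iota:I_a\to\{J_1,\dots,J_n\}$, $$\{I_i\}\circ_{I_a}^{\iota}\{J_j\}=\{I_i\}_{i\neq a}\cup\{J_j\cup\iota^{-1}(J_j)\}_{j=1}^n .$$ Composition: for $\{I_i\},\{J_j\}$ with disjoint supports, $$\{I_i\}\circ\{J_j\}=\sum_a\sum_{\iota}\{I_i\}\circ_{I_a}^{\iota}\{J_j\}\in\mathbb{K}(\mathcal{P}^2_{dis}(A)),$$ the sum being over all blocks $I_a$ of $\{I_i\}$ and all maps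 $\iota:I_a\to\{J_j\}$. The composition, and hence the bracket, is extended bilinearly to linear combinations of partitions (whenever the supports of the two arguments are disjoint). *)

theory Defs
  imports "HOL-Library.Poly_Mapping" "HOL-Library.Disjoint_Sets" "HOL-Library.FuncSet"
begin

text \<open>Blocks being nonempty and pairwise disjoint, a family has no repeated block, so an
  unordered family of blocks is a set of sets. The empty family (\<open>m = 0\<close>) is included.\<close>

definition P2dis :: "'a set \<Rightarrow> 'a set set set" where
  "P2dis A = {P. \<Union>P \<subseteq> A \<and> {} \<notin> P \<and> disjoint P}"

definition supp :: "'a set set \<Rightarrow> 'a set" where
  "supp P = \<Union>P"

text \<open>The free vector space on \<^term>\<open>P2dis A\<close> consists of the finitely supported functions
  \<open>'a set set \<Rightarrow>\<^sub>0 'k\<close> whose keys lie in \<^term>\<open>P2dis A\<close>.\<close>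

definition KP2dis :: "'a set \<Rightarrow> ('a set set \<Rightarrow>\<^sub>0 'k::field_char_0) set" where
  "KP2dis A = {X. Poly_Mapping.keys X \<subseteq> P2dis A}"

definition smul :: "'k::field_char_0 \<Rightarrow> ('b \<Rightarrow>\<^sub>0 'k) \<Rightarrow> ('b \<Rightarrow>\<^sub>0 'k)" where
  "smul c X = Poly_Mapping.map (\<lambda>x. c * x) X"

definition basis :: "'b \<Rightarrow> ('b \<Rightarrow>\<^sub>0 'k::field_char_0)" where
  "basis P = Poly_Mapping.single P 1"

definition insertion :: "'a set set \<Rightarrow> 'a set \<Rightarrow> ('a \<Rightarrow> 'a set) \<Rightarrow> 'a set set \<Rightarrow> 'a set set" where
  "insertion I a \<iota> J = (I - {a}) \<union> (\<lambda>B. B \<union> {x \<in> a. \<iota> x = B}) ` J"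

text \<open>The extensional function space makes each map \<open>a \<rightarrow> J\<close> be counted exactly once.\<close>

definition pcomp :: "'a set set \<Rightarrow> 'a set set \<Rightarrow> ('a set set \<Rightarrow>\<^sub>0 'k::field_char_0)" where
  "pcomp I J = (\<Sum>a\<in>I. \<Sum>\<iota>\<in>(a \<rightarrow>\<^sub>E J). basis (insertion I a \<iota> J))"

text \<open>The bilinear extension is total; it agrees with the composition of the text whenever
  every key of \<open>X\<close> has support disjoint from that of every key of \<open>Y\<close>, and carries no meaning
  otherwise.\<close>

definition lcomp :: "('a set set \<Rightarrow>\<^sub>0 'k::field_char_0) \<Rightarrow> ('a set set \<Rightarrow>\<^sub>0 'k) \<Rightarrow> ('a set set \<Rightarrow>\<^sub>0 'k)"
  where
  "lcomp X Y = (\<Sum>P\<in>Poly_Mapping.keys X. \<Sum>Q\<in>Poly_Mapping.keys Y.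
      smul (Poly_Mapping.lookup X P * Poly_Mapping.lookup Y Q) (pcomp P Q))"

definition bracket ::
  "('a set set \<Rightarrow>\<^sub>0 'k::field_char_0) \<Rightarrow> ('a set set \<Rightarrow>\<^sub>0 'k) \<Rightarrow> ('a set set \<Rightarrow>\<^sub>0 'k)" where
  "bracket X Y = lcomp X Y - lcomp Y X"

lemma lookup_smul: "Poly_Mapping.lookup (smul c X) P = c * Poly_Mapping.lookup X P"
  unfolding smul_def by (simp add: Poly_Mapping.map.rep_eq when_def)

lemma smul_0: "smul 0 X = 0"
  and smul_1: "smul 1 X = X"
  and smul_smul: "smul c (smul d X) = smul (c * d) X"
  and smul_add_left: "smul (c + d) X = smul c X + smul d X"
  and smul_add_right: "smul c (X + Y) = smul c X + smul c Y"
  by (rule poly_mapping_eqI; simp add: lookup_smul lookup_add algebra_simps)+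

lemma smul_sum: "smul c (sum f S) = (\<Sum>x\<in>S. smul c (f x))"
  by (rule poly_mapping_eqI) (simp add: lookup_smul lookup_sum sum_distrib_left)

lemma lcomp_superset:
  assumes "finite S" "finite T" "Poly_Mapping.keys X \<subseteq> S" "Poly_Mapping.keys Y \<subseteq> T"
  shows "lcomp X Y = (\<Sum>P\<in>S. \<Sum>Q\<in>T.
      smul (Poly_Mapping.lookup X P * Poly_Mapping.lookup Y Q) (pcomp P Q))"
proof -
  have "(\<Sum>Q\<in>Poly_Mapping.keys Y. smul (Poly_Mapping.lookup X P * Poly_Mapping.lookup Y Q) (pcomp P Q))
      = (\<Sum>Q\<in>T. smul (Poly_Mapping.lookup X P * Poly_Mapping.lookup Y Q) (pcomp P Q))" for P
    using assms by (intro sum.mono_neutral_left) (auto simp: in_keys_iff smul_0)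
  then show ?thesis
    unfolding lcomp_def using assms
    by (simp, intro sum.mono_neutral_left) (auto simp: in_keys_iff smul_0)
qed

lemma lcomp_basis: "lcomp (basis I) (basis J) = pcomp I J"
  by (simp add: lcomp_def basis_def smul_1)

lemma lcomp_add_left: "lcomp (X + X') Y = lcomp X Y + lcomp X' Y"
proof -
  let ?S = "Poly_Mapping.keys X \<union> Poly_Mapping.keys X'" and ?T = "Poly_Mapping.keys Y"
  have k: "Poly_Mapping.keys (X + X') \<subseteq> ?S" by (rule Poly_Mapping.keys_add)
  show ?thesis
    using k by (subst (1 2 3) lcomp_superset[of ?S ?T])
      (auto simp: lookup_add distrib_right smul_add_left sum.distrib)
qed

lemma lcomp_add_right: "lcomp X (Y + Y') = lcomp X Y + lcomp X Y'"
proof -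
  let ?S = "Poly_Mapping.keys X" and ?T = "Poly_Mapping.keys Y \<union> Poly_Mapping.keys Y'"
  have k: "Poly_Mapping.keys (Y + Y') \<subseteq> ?T" by (rule Poly_Mapping.keys_add)
  show ?thesis
    using k by (subst (1 2 3) lcomp_superset[of ?S ?T])
      (auto simp: lookup_add distrib_left smul_add_left sum.distrib)
qed

lemma keys_smul: "Poly_Mapping.keys (smul c X) \<subseteq> Poly_Mapping.keys X"
  by (auto simp: in_keys_iff lookup_smul)

lemma lcomp_smul_left: "lcomp (smul c X) Y = smul c (lcomp X Y)"
  by (subst (1 2) lcomp_superset[of "Poly_Mapping.keys X" "Poly_Mapping.keys Y"])
    (use keys_smul[of c X] in \<open>auto simp: lookup_smul smul_sum smul_smul mult_ac\<close>)

lemma lcomp_smul_right: "lcomp X (smul c Y) = smul c (lcomp X Y)"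
  by (subst (1 2) lcomp_superset[of "Poly_Mapping.keys X" "Poly_Mapping.keys Y"])
    (use keys_smul[of c Y] in \<open>auto simp: lookup_smul smul_sum smul_smul mult_ac\<close>)

lemma insertion_in_P2dis:
  assumes "I \<in> P2dis A" "J \<in> P2dis A" "supp I \<inter> supp J = {}" "a \<in> I" "\<iota> \<in> a \<rightarrow>\<^sub>E J"
  shows "insertion I a \<iota> J \<in> P2dis A" "supp (insertion I a \<iota> J) = supp I \<union> supp J"
proof -
  have dI: "B \<inter> C = {}" if "B \<in> I" "C \<in> I" "B \<noteq> C" for B C
    using assms(1) that by (auto simp: P2dis_def pairwise_def disjnt_def)
  have dJ: "B \<inter> C = {}" if "B \<in> J" "C \<in> J" "B \<noteq> C" for B C
    using assms(2) that by (auto simp: P2dis_def pairwise_def disjnt_def)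
  have dIJ: "B \<inter> C = {}" if "B \<in> I" "C \<in> J" for B C
    using assms(3) that by (auto simp: supp_def)
  have "disjoint (insertion I a \<iota> J)"
    unfolding pairwise_def disjnt_def insertion_def
  proof (intro ballI impI)
    let ?f = "\<lambda>B. B \<union> {x \<in> a. \<iota> x = B}"
    fix B C
    assume BC: "B \<in> I - {a} \<union> ?f ` J" "C \<in> I - {a} \<union> ?f ` J" "B \<noteq> C"
    have old_new: "D \<inter> ?f E = {}" if "D \<in> I - {a}" "E \<in> J" for D E
      using dI[of D a] dIJ[of D E] that assms(4) by auto
    have new_new: "?f D \<inter> ?f E = {}" if "D \<in> J" "E \<in> J" "D \<noteq> E" for D E
      using dJ[of D E] dIJ[of a D] dIJ[of a E] that assms(4) by auto
    from BC(1,2) show "B \<inter> C = {}"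
    proof (elim UnE imageE)
      assume "B \<in> I - {a}" "C \<in> I - {a}"
      then show ?thesis using dI[of B C] BC(3) by simp
    next
      fix E assume "B \<in> I - {a}" "C = ?f E" "E \<in> J"
      then show ?thesis using old_new[of B E] by simp
    next
      fix D assume "B = ?f D" "D \<in> J" "C \<in> I - {a}"
      then show ?thesis using old_new[of C D] by (simp only: Int_commute)
    next
      fix D E assume *: "B = ?f D" "D \<in> J" "C = ?f E" "E \<in> J"
      then have "D \<noteq> E" using BC(3) by blast
      then show ?thesis unfolding *(1,3) by (rule new_new[OF *(2,4)])
    qed
  qed
  moreover show "supp (insertion I a \<iota> J) = supp I \<union> supp J"
  proof
    show "supp (insertion I a \<iota> J) \<subseteq> supp I \<union> supp J"
      using assms(4) by (auto simp: supp_def insertion_def)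
    show "supp I \<union> supp J \<subseteq> supp (insertion I a \<iota> J)"
    proof
      fix x assume "x \<in> supp I \<union> supp J"
      then consider B where "B \<in> I - {a}" "x \<in> B" | "x \<in> a" | B where "B \<in> J" "x \<in> B"
        by (auto simp: supp_def)
      then show "x \<in> supp (insertion I a \<iota> J)"
      proof cases
        case 2
        with assms(5) have "\<iota> x \<in> J" by (auto dest: PiE_mem)
        with 2 show ?thesis by (auto simp: supp_def insertion_def)
      qed (auto simp: supp_def insertion_def)
    qed
  qed
  moreover have "{} \<notin> insertion I a \<iota> J" "supp I \<subseteq> A" "supp J \<subseteq> A"
    using assms(1,2) by (auto simp: P2dis_def insertion_def supp_def)
  ultimately show "insertion I a \<iota> J \<in> P2dis A"
    unfolding P2dis_def supp_def by simp
qed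

lemma pcomp_in_KP2dis:
  fixes I J :: "'a set set"
  defines "X \<equiv> (pcomp I J :: 'a set set \<Rightarrow>\<^sub>0 'k::field_char_0)"
  assumes "I \<in> P2dis A" "J \<in> P2dis A" "supp I \<inter> supp J = {}"
  shows "X \<in> KP2dis A"
    and "\<And>P. P \<in> Poly_Mapping.keys X \<Longrightarrow> supp P = supp I \<union> supp J"
proof -
  have *: "\<exists>a\<in>I. \<exists>\<iota>\<in>(a \<rightarrow>\<^sub>E J). P = insertion I a \<iota> J"
    if "P \<in> Poly_Mapping.keys X" for P
  proof (rule ccontr)
    assume "\<not> ?thesis"
    then have "Poly_Mapping.lookup X P = 0"
      unfolding X_def pcomp_def basis_def lookup_sum lookup_single
      by (intro sum.neutral ballI) (auto simp: when_def)
    with that show False by (simp add: in_keys_iff)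
  qed
  show "X \<in> KP2dis A"
    using * insertion_in_P2dis(1)[OF assms(2-4)] unfolding KP2dis_def by blast
  show "supp P = supp I \<union> supp J" if "P \<in> Poly_Mapping.keys X" for P
    using *[OF that] insertion_in_P2dis(2)[OF assms(2-4)] by auto
qed

end

theory Submission
  imports Defs
begin

text \<open>The composition is right pre-Lie: \<open>(I \<circ> J) \<circ> K - I \<circ> (J \<circ> K)\<close> is the sum of the terms in which
  two different blocks of \<open>I\<close> are distributed, one over \<open>J\<close> and the other over \<open>K\<close>, and this is
  symmetric in \<open>J\<close> and \<open>K\<close>. The terms that cancel are those in which a block \<open>a\<close> of \<open>I\<close> is
  distributed over \<open>J\<close> and one block \<open>j\<close> of \<open>J\<close> over \<open>K\<close>: in either order, an element of \<open>a\<close> ends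
  up in a block of \<open>J - {j}\<close> or in a block of \<open>K\<close>. The commutator of a pre-Lie product satisfies the
  Jacobi identity.\<close>

section \<open>Enlarged blocks and the traces that recover the original ones\<close>

definition absorb :: "'a set \<Rightarrow> ('a \<Rightarrow> 'a set) \<Rightarrow> 'a set \<Rightarrow> 'a set" where
  "absorb a \<iota> B = B \<union> {x \<in> a. \<iota> x = B}"

lemma insertion_absorb: "insertion I a \<iota> J = (I - {a}) \<union> absorb a \<iota> ` J"
  unfolding insertion_def absorb_def ..

lemma finite_P2dis:
  assumes "finite A" "I \<in> P2dis A"
  shows "finite I" and "a \<in> I \<Longrightarrow> finite a"
proof -
  have "finite (\<Union>I)"
    using assms by (auto simp: P2dis_def intro: finite_subset)
  then show "finite I" and "a \<in> I \<Longrightarrow> finite a"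
    by (auto intro: finite_UnionD finite_subset[of a "\<Union>I"])
qed

lemma P2dis_nonempty: "I \<in> P2dis A \<Longrightarrow> a \<in> I \<Longrightarrow> a \<noteq> {}"
  by (auto simp: P2dis_def)

lemma subset_supp: "a \<in> I \<Longrightarrow> a \<subseteq> supp I"
  by (auto simp: supp_def)

text \<open>The added elements come from \<open>a\<close>, which misses \<open>supp J\<close>. So
  the trace on \<open>supp J\<close> undoes \<open>absorb\<close>; this yields injectivity here and
  an inverse reindexing later.\<close>

lemma absorb_Int_supp:
  assumes "a \<inter> supp J = {}" "B \<in> J"
  shows "absorb a \<iota> B \<inter> supp J = B"
  using assms by (auto simp: absorb_def supp_def)

lemma inj_on_absorb:
  assumes "a \<inter> supp J = {}"
  shows "inj_on (absorb a \<iota>) J"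
  by (rule inj_onI) (metis absorb_Int_supp[OF assms])

text \<open>A block of \<open>J\<close> is nonempty, so the enlarged block meets
  \<open>supp J\<close>, while the blocks of \<open>I\<close> do not.\<close>

lemma absorb_notin:
  assumes "J \<in> P2dis A" "supp I \<inter> supp J = {}" "B \<in> J"
  shows "absorb a \<iota> B \<notin> I"
  using P2dis_nonempty[OF assms(1,3)] assms(2,3) by (auto simp: absorb_def supp_def)

section \<open>Iterated insertions\<close>

text \<open>A block of the inserted family is either an untouched \<open>b\<close> in
  \<open>I - {a}\<close> or \<open>absorb a \<iota> j\<close> for exactly one \<open>j\<close>. So
  the outer sum splits in two, and the second part is reindexed over \<open>J\<close>.\<close>

lemma pcomp_insertion:
  fixes I J K :: "'a set set"
  assumes fin: "finite A" and I: "I \<in> P2dis A" and J: "J \<in> P2dis A"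
    and IJ: "supp I \<inter> supp J = {}" and a: "a \<in> I"
  shows "(pcomp (insertion I a \<iota> J) K :: 'a set set \<Rightarrow>\<^sub>0 'k::field_char_0) =
    (\<Sum>b\<in>I-{a}. \<Sum>\<kappa>\<in>b \<rightarrow>\<^sub>E K. basis ((I - {a,b}) \<union> absorb a \<iota> ` J \<union> absorb b \<kappa> ` K)) +
    (\<Sum>j\<in>J. \<Sum>\<kappa>\<in>absorb a \<iota> j \<rightarrow>\<^sub>E K.
       basis ((I - {a}) \<union> absorb a \<iota> ` (J - {j}) \<union> absorb (absorb a \<iota> j) \<kappa> ` K))"
proof -
  note notin = absorb_notin[OF J IJ]
  have inj: "inj_on (absorb a \<iota>) J"
    using IJ subset_supp[OF a] by (intro inj_on_absorb) auto
  have 1: "insertion (insertion I a \<iota> J) b \<kappa> K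
      = (I - {a,b}) \<union> absorb a \<iota> ` J \<union> absorb b \<kappa> ` K" if "b \<in> I - {a}" for b \<kappa>
    using that notin unfolding insertion_absorb by blast
  \<comment> \<open>By injectivity, removing one enlarged block amounts to removing \<open>j\<close>
    before enlarging.\<close>
  have 2: "insertion (insertion I a \<iota> J) (absorb a \<iota> j) \<kappa> K
      = (I - {a}) \<union> absorb a \<iota> ` (J - {j}) \<union> absorb (absorb a \<iota> j) \<kappa> ` K" if "j \<in> J" for j \<kappa>
    using that notin[OF that] inj_on_image_set_diff[OF inj, of J "{j}"]
    unfolding insertion_absorb by auto
  have "(pcomp (insertion I a \<iota> J) K :: 'a set set \<Rightarrow>\<^sub>0 'k) =
    (\<Sum>b\<in>I-{a}. \<Sum>\<kappa>\<in>b \<rightarrow>\<^sub>E K. basis (insertion (insertion I a \<iota> J) b \<kappa> K)) +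
    (\<Sum>b\<in>absorb a \<iota> ` J. \<Sum>\<kappa>\<in>b \<rightarrow>\<^sub>E K. basis (insertion (insertion I a \<iota> J) b \<kappa> K))"
    unfolding pcomp_def
    by (subst insertion_absorb, rule sum.union_disjoint)
      (use notin finite_P2dis(1)[OF fin I] finite_P2dis(1)[OF fin J] in auto)
  then show ?thesis
    by (simp add: sum.reindex[OF inj] 1 2)
qed

text \<open>An element of \<open>a\<close> with \<open>\<iota> x = j\<close> is sent on to \<open>K\<close> by \<open>\<kappa>\<close>. Conversely, the block of \<open>K\<close> is
  recovered from a block of \<open>insertion J j \<kappa> K\<close> by intersecting with \<open>supp K\<close>.\<close>

lemma sum_nested_insertion:
  fixes I J K :: "'a set set" and F :: "'a set set \<Rightarrow> 'b::comm_monoid_add"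
  assumes fin: "finite A" and I: "I \<in> P2dis A" and J: "J \<in> P2dis A" and K: "K \<in> P2dis A"
    and IJ: "supp I \<inter> supp J = {}" and JK: "supp J \<inter> supp K = {}"
    and a: "a \<in> I" and j: "j \<in> J"
  shows "(\<Sum>\<iota>\<in>a \<rightarrow>\<^sub>E J. \<Sum>\<kappa>\<in>absorb a \<iota> j \<rightarrow>\<^sub>E K.
      F ((I - {a}) \<union> absorb a \<iota> ` (J - {j}) \<union> absorb (absorb a \<iota> j) \<kappa> ` K)) =
    (\<Sum>\<kappa>\<in>j \<rightarrow>\<^sub>E K. \<Sum>\<iota>\<in>a \<rightarrow>\<^sub>E insertion J j \<kappa> K. F (insertion I a \<iota> (insertion J j \<kappa> K)))"
    (is "?L = ?R")
proof -
  have fK: "finite K" and fJ: "finite J" and fa: "finite a" and fj: "finite j"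
    using finite_P2dis fin I J K a j by auto
  have aj: "a \<inter> j = {}" and jK: "j \<inter> supp K = {}"
    using IJ JK a j by (auto simp: supp_def)
  note trace = absorb_Int_supp[OF jK]
  have notin: "absorb j \<kappa> B \<notin> J" if "B \<in> K" for B \<kappa>
    using absorb_notin[OF K JK that] .
  \<comment> \<open>Dependent pairs are needed: in \<open>S\<close> the domain of \<kappa> depends
    on \<iota>, in \<open>T\<close> the codomain of \<iota> depends on \<kappa>.\<close>
  define S where "S = (SIGMA \<iota>:a \<rightarrow>\<^sub>E J. absorb a \<iota> j \<rightarrow>\<^sub>E K)"
  define T where "T = (SIGMA \<kappa>:j \<rightarrow>\<^sub>E K. a \<rightarrow>\<^sub>E insertion J j \<kappa> K)"
  \<comment> \<open>\<open>f\<close> sends each element of \<open>a\<close> directly to its final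
    target: for an element passing through \<open>j\<close>, this is the block of \<open>K\<close>
    as enlarged by \<open>j\<close>.\<close>
  define f :: "('a \<Rightarrow> 'a set) \<times> ('a \<Rightarrow> 'a set) \<Rightarrow> ('a \<Rightarrow> 'a set) \<times> ('a \<Rightarrow> 'a set)" where
    "f = (\<lambda>(\<iota>,\<kappa>). (restrict \<kappa> j,
      \<lambda>x\<in>a. if \<iota> x = j then absorb j (restrict \<kappa> j) (\<kappa> x) else \<iota> x))"
  \<comment> \<open>A target outside \<open>J - {j}\<close> is an enlarged block of
    \<open>K\<close>: \<open>g\<close> redirects the element to \<open>j\<close> and reads off the
    block of \<open>K\<close> as a trace.\<close>
  define g :: "('a \<Rightarrow> 'a set) \<times> ('a \<Rightarrow> 'a set) \<Rightarrow> ('a \<Rightarrow> 'a set) \<times> ('a \<Rightarrow> 'a set)" where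
    "g = (\<lambda>(\<kappa>,\<iota>). (\<lambda>x\<in>a. if \<iota> x \<in> J - {j} then \<iota> x else j,
      \<lambda>x\<in>j \<union> {x \<in> a. \<iota> x \<notin> J - {j}}. if x \<in> j then \<kappa> x else \<iota> x \<inter> supp K))"
  have finL: "finite (absorb a \<iota> j \<rightarrow>\<^sub>E K)" for \<iota>
    using fa fj fK by (intro finite_PiE) (auto simp: absorb_def)
  have finR: "finite (a \<rightarrow>\<^sub>E insertion J j \<kappa> K)" for \<kappa>
    using fa fJ fK by (intro finite_PiE) (auto simp: insertion_def)
  have L: "?L = (\<Sum>(\<iota>,\<kappa>)\<in>S.
      F ((I - {a}) \<union> absorb a \<iota> ` (J - {j}) \<union> absorb (absorb a \<iota> j) \<kappa> ` K))"
    unfolding S_def using fa fJ finL by (intro sum.Sigma) (auto intro: finite_PiE)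
  have R: "?R = (\<Sum>(\<kappa>,\<iota>)\<in>T. F (insertion I a \<iota> (insertion J j \<kappa> K)))"
    unfolding T_def using fj fK finR by (intro sum.Sigma) (auto intro: finite_PiE)
  have fT: "f p \<in> T" and gf: "g (f p) = p"
    and val: "(\<lambda>(\<kappa>,\<iota>). F (insertion I a \<iota> (insertion J j \<kappa> K))) (f p) =
      (\<lambda>(\<iota>,\<kappa>). F ((I - {a}) \<union> absorb a \<iota> ` (J - {j}) \<union> absorb (absorb a \<iota> j) \<kappa> ` K)) p"
    if "p \<in> S" for p
  proof -
    obtain \<iota> \<kappa> where p: "p = (\<iota>,\<kappa>)" by fastforce
    with that have i: "\<iota> \<in> a \<rightarrow>\<^sub>E J" and k: "\<kappa> \<in> absorb a \<iota> j \<rightarrow>\<^sub>E K"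
      by (auto simp: S_def)
    have iJ: "\<iota> x \<in> J" if "x \<in> a" for x using i that by auto
    have kj: "\<kappa> x \<in> K" if "x \<in> j" for x using k that by (auto simp: absorb_def PiE_def Pi_def)
    have ka: "\<kappa> x \<in> K" if "x \<in> a" "\<iota> x = j" for x
      using k that by (auto simp: absorb_def PiE_def Pi_def)
    define \<kappa>' where "\<kappa>' = restrict \<kappa> j"
    define \<iota>' where "\<iota>' = (\<lambda>x\<in>a. if \<iota> x = j then absorb j \<kappa>' (\<kappa> x) else \<iota> x)"
    have fp: "f (\<iota>,\<kappa>) = (\<kappa>', \<iota>')" unfolding f_def prod.case \<iota>'_def \<kappa>'_def ..
    show "f p \<in> T"
      unfolding p fp T_def using iJ kj ka by (auto simp: \<iota>'_def \<kappa>'_def insertion_absorb)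
    \<comment> \<open>Enlarged blocks of \<open>K\<close> never lie in \<open>J\<close>, so the
      target of \<open>x\<close> shows whether \<open>x\<close> passed through
      \<open>j\<close>.\<close>
    have old: "\<iota>' x \<in> J - {j} \<longleftrightarrow> \<iota> x \<noteq> j" if "x \<in> a" for x
      using that iJ notin[OF ka] by (auto simp: \<iota>'_def)
    have dom: "j \<union> {x \<in> a. \<iota>' x \<notin> J - {j}} = absorb a \<iota> j"
      using old by (auto simp: absorb_def)
    show "g (f p) = p"
      unfolding p fp g_def prod.case dom
    proof (rule arg_cong2[where f = Pair])
      show "(\<lambda>x\<in>a. if \<iota>' x \<in> J - {j} then \<iota>' x else j) = \<iota>"
      proof
        fix x
        have "\<iota>' x = \<iota> x" if "x \<in> a" "\<iota> x \<noteq> j"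
          using that by (simp add: \<iota>'_def)
        then show "(\<lambda>x\<in>a. if \<iota>' x \<in> J - {j} then \<iota>' x else j) x = \<iota> x"
          using old[of x] PiE_arb[OF i, of x] by (cases "x \<in> a") (simp_all del: Diff_iff)
      qed
      show "(\<lambda>x\<in>absorb a \<iota> j. if x \<in> j then \<kappa>' x else \<iota>' x \<inter> supp K) = \<kappa>"
      proof
        fix x
        consider "x \<notin> absorb a \<iota> j" | "x \<in> j" | "x \<in> a" "x \<notin> j" "\<iota> x = j"
          by (auto simp: absorb_def)
        then show "(\<lambda>x\<in>absorb a \<iota> j. if x \<in> j then \<kappa>' x else \<iota>' x \<inter> supp K) x = \<kappa> x"
        proof cases
          case 1 then show ?thesis using PiE_arb[OF k] by simp
        next
          case 2 then show ?thesis by (simp add: \<kappa>'_def absorb_def)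
        next
          case 3 then show ?thesis using trace[OF ka] by (simp add: \<iota>'_def absorb_def[of a])
        qed
      qed
    qed
    have "absorb a \<iota>' B = absorb a \<iota> B" if "B \<in> J - {j}" for B
      using that notin[OF ka] by (auto simp: absorb_def[of a] \<iota>'_def split: if_splits)
    then have 1: "absorb a \<iota>' ` (J - {j}) = absorb a \<iota> ` (J - {j})" by auto
    \<comment> \<open>Both sides consist of \<open>B\<close>, the elements of \<open>j\<close> that
      \<kappa> sends to \<open>B\<close>, and the elements of \<open>a\<close> sent to
      \<open>j\<close> and from there to \<open>B\<close>.\<close>
    have "absorb a \<iota>' (absorb j \<kappa>' B) = absorb (absorb a \<iota> j) \<kappa> B" if B: "B \<in> K" for B
    proof -
      have "\<iota>' x = absorb j \<kappa>' B \<longleftrightarrow> \<iota> x = j \<and> \<kappa> x = B" if x: "x \<in> a" for x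
        using iJ[OF x] notin[OF B, of \<kappa>'] trace[OF ka[OF x], of \<kappa>'] trace[OF B, of \<kappa>'] x
        by (auto simp: \<iota>'_def)
      then have "absorb a \<iota>' (absorb j \<kappa>' B) = absorb j \<kappa>' B \<union> {x \<in> a. \<iota> x = j \<and> \<kappa> x = B}"
        by (auto simp: absorb_def[of a])
      then show ?thesis by (auto simp: absorb_def \<kappa>'_def)
    qed
    then have 2: "absorb a \<iota>' ` absorb j \<kappa>' ` K = absorb (absorb a \<iota> j) \<kappa> ` K"
      by (auto simp: image_image)
    show "(\<lambda>(\<kappa>,\<iota>). F (insertion I a \<iota> (insertion J j \<kappa> K))) (f p) =
      (\<lambda>(\<iota>,\<kappa>). F ((I - {a}) \<union> absorb a \<iota> ` (J - {j}) \<union> absorb (absorb a \<iota> j) \<kappa> ` K)) p"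
      unfolding p fp prod.case insertion_absorb image_Un 1 2 by (simp add: Un_assoc)
  qed
  have gS: "g q \<in> S" and fg: "f (g q) = q" if "q \<in> T" for q
  proof -
    obtain \<kappa> \<iota> where q: "q = (\<kappa>,\<iota>)" by fastforce
    with that have k: "\<kappa> \<in> j \<rightarrow>\<^sub>E K" and i: "\<iota> \<in> a \<rightarrow>\<^sub>E insertion J j \<kappa> K"
      by (auto simp: T_def)
    have kj: "\<kappa> x \<in> K" if "x \<in> j" for x using k that by auto
    have new: "\<iota> x \<inter> supp K \<in> K" "absorb j \<kappa> (\<iota> x \<inter> supp K) = \<iota> x"
      if x: "x \<in> a" "\<iota> x \<notin> J - {j}" for x
    proof -
      obtain B where "B \<in> K" "\<iota> x = absorb j \<kappa> B"
        using PiE_mem[OF i x(1)] x(2) by (auto simp: insertion_absorb)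
      then show "\<iota> x \<inter> supp K \<in> K" "absorb j \<kappa> (\<iota> x \<inter> supp K) = \<iota> x"
        using trace by auto
    qed
    define \<iota>' where "\<iota>' = (\<lambda>x\<in>a. if \<iota> x \<in> J - {j} then \<iota> x else j)"
    define \<kappa>' where "\<kappa>' = (\<lambda>x\<in>j \<union> {x \<in> a. \<iota> x \<notin> J - {j}}. if x \<in> j then \<kappa> x else \<iota> x \<inter> supp K)"
    have gq: "g (\<kappa>,\<iota>) = (\<iota>', \<kappa>')" unfolding g_def prod.case \<iota>'_def \<kappa>'_def ..
    have old: "\<iota>' x = j \<longleftrightarrow> \<iota> x \<notin> J - {j}" if "x \<in> a" for x
      using that by (auto simp: \<iota>'_def)
    have dom: "absorb a \<iota>' j = j \<union> {x \<in> a. \<iota> x \<notin> J - {j}}"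
      using old by (auto simp: absorb_def)
    have "\<iota>' \<in> a \<rightarrow>\<^sub>E J" using j by (auto simp: \<iota>'_def)
    moreover have "\<kappa>' \<in> absorb a \<iota>' j \<rightarrow>\<^sub>E K"
      unfolding dom \<kappa>'_def restrict_PiE_iff using kj new(1) by auto
    ultimately show "g q \<in> S" unfolding q gq S_def by blast
    have rk: "restrict \<kappa>' j = \<kappa>"
      using PiE_arb[OF k] by (intro ext) (auto simp: \<kappa>'_def restrict_def)
    have "(\<lambda>x\<in>a. if \<iota>' x = j then absorb j \<kappa> (\<kappa>' x) else \<iota>' x) = \<iota>"
    proof
      fix x
      \<comment> \<open>An \<open>x\<close> in both \<open>a\<close> and \<open>j\<close> is
        excluded by \<open>aj\<close>; there \<kappa>' would follow \<kappa> instead of the trace of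
        \<open>\<iota> x\<close>.\<close>
      consider "x \<notin> a" | "x \<in> a" "\<iota> x \<in> J - {j}" | "x \<in> a" "x \<notin> j" "\<iota> x \<notin> J - {j}"
        using aj by blast
      then show "(\<lambda>x\<in>a. if \<iota>' x = j then absorb j \<kappa> (\<kappa>' x) else \<iota>' x) x = \<iota> x"
      proof cases
        case 1 then show ?thesis using PiE_arb[OF i] by simp
      next
        case 2 then show ?thesis by (simp add: \<iota>'_def)
      next
        case 3
        then have "\<kappa>' x = \<iota> x \<inter> supp K" unfolding \<kappa>'_def by simp
        then show ?thesis using 3 old[of x] new(2)[of x] by simp
      qed
    qed
    then show "f (g q) = q" unfolding q gq f_def prod.case rk by simp
  qed
  show ?thesis unfolding L R
    by (rule sum.reindex_bij_witness[where i = g and j = f]) (use fT gf val gS fg in auto)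
qed

section \<open>Composition of finite sums and differences\<close>

lemma lcomp_zero_left: "lcomp 0 Y = 0"
  by (simp add: lcomp_def)

lemma lcomp_zero_right: "lcomp X 0 = 0"
  by (simp add: lcomp_def)

lemma lcomp_sum_left: "lcomp (sum f S) Y = (\<Sum>x\<in>S. lcomp (f x) Y)"
  by (induction S rule: infinite_finite_induct) (auto simp: lcomp_zero_left lcomp_add_left)

lemma lcomp_sum_right: "lcomp X (sum f S) = (\<Sum>x\<in>S. lcomp X (f x))"
  by (induction S rule: infinite_finite_induct) (auto simp: lcomp_zero_right lcomp_add_right)

lemma lcomp_diff_left: "lcomp (X - X') Y = lcomp X Y - lcomp X' Y"
  using lcomp_add_left[of "X - X'" X' Y] by (simp add: algebra_simps)

lemma lcomp_diff_right: "lcomp X (Y - Y') = lcomp X Y - lcomp X Y'"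
  using lcomp_add_right[of X "Y - Y'" Y'] by (simp add: algebra_simps)

section \<open>The associator and its symmetry\<close>

definition disjoint_insertions ::
  "'a set set \<Rightarrow> 'a set set \<Rightarrow> 'a set set \<Rightarrow> ('a set set \<Rightarrow>\<^sub>0 'k::field_char_0)" where
  "disjoint_insertions I J K = (\<Sum>a\<in>I. \<Sum>b\<in>I-{a}. \<Sum>\<iota>\<in>a \<rightarrow>\<^sub>E J. \<Sum>\<kappa>\<in>b \<rightarrow>\<^sub>E K.
     basis ((I - {a,b}) \<union> absorb a \<iota> ` J \<union> absorb b \<kappa> ` K))"

text \<open>Renaming the ordered pair \<open>(a,b)\<close> as \<open>(b,a)\<close> exchanges the
  roles of \<open>J\<close> and \<open>K\<close> and leaves the union of blocks unchanged.\<close>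

lemma disjoint_insertions_commute:
  assumes "finite I"
  shows "disjoint_insertions I J K = disjoint_insertions I K J"
proof -
  \<comment> \<open>Writing the range of \<open>b\<close> through the symmetric condition
    \<open>a \<noteq> b\<close> lets the dependent double sum be swapped.\<close>
  have "disjoint_insertions I J K = (\<Sum>a\<in>I. \<Sum>b\<in>{b\<in>I. a \<noteq> b}. \<Sum>\<iota>\<in>a \<rightarrow>\<^sub>E J. \<Sum>\<kappa>\<in>b \<rightarrow>\<^sub>E K.
     basis ((I - {a,b}) \<union> absorb a \<iota> ` J \<union> absorb b \<kappa> ` K))"
    unfolding disjoint_insertions_def by (intro sum.cong) auto
  also have "\<dots> = (\<Sum>b\<in>I. \<Sum>a\<in>{a\<in>I. a \<noteq> b}. \<Sum>\<iota>\<in>a \<rightarrow>\<^sub>E J. \<Sum>\<kappa>\<in>b \<rightarrow>\<^sub>E K.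
     basis ((I - {a,b}) \<union> absorb a \<iota> ` J \<union> absorb b \<kappa> ` K))"
    using assms by (intro sum.swap_restrict)
  also have "\<dots> = (\<Sum>b\<in>I. \<Sum>a\<in>{a\<in>I. a \<noteq> b}. \<Sum>\<kappa>\<in>b \<rightarrow>\<^sub>E K. \<Sum>\<iota>\<in>a \<rightarrow>\<^sub>E J.
     basis ((I - {a,b}) \<union> absorb a \<iota> ` J \<union> absorb b \<kappa> ` K))"
    by (intro sum.cong refl sum.swap)
  also have "\<dots> = disjoint_insertions I K J"
    unfolding disjoint_insertions_def by (intro sum.cong arg_cong[where f = basis]) auto
  finally show ?thesis .
qed

text \<open>The block distributed over \<open>K\<close> is either a second block of
  \<open>I\<close>, which gives \<open>disjoint_insertions\<close>, or an enlarged block of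
  \<open>J\<close>, which \<open>sum_nested_insertion\<close> turns into the right-nested
  composition.\<close>

lemma lcomp_associator:
  fixes I J K :: "'a set set"
  assumes fin: "finite A" and I: "I \<in> P2dis A" and J: "J \<in> P2dis A" and K: "K \<in> P2dis A"
    and IJ: "supp I \<inter> supp J = {}" and JK: "supp J \<inter> supp K = {}"
  shows "(lcomp (lcomp (basis I) (basis J)) (basis K) :: 'a set set \<Rightarrow>\<^sub>0 'k::field_char_0) =
    lcomp (basis I) (lcomp (basis J) (basis K)) + disjoint_insertions I J K"
proof -
  let ?D = "\<lambda>a b \<iota> \<kappa>. basis ((I - {a,b}) \<union> absorb a \<iota> ` J \<union> absorb b \<kappa> ` K) :: 'a set set \<Rightarrow>\<^sub>0 'k"
  let ?N = "\<lambda>a j \<iota> \<kappa>. basis ((I - {a}) \<union> absorb a \<iota> ` (J - {j}) \<union> absorb (absorb a \<iota> j) \<kappa> ` K)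
    :: 'a set set \<Rightarrow>\<^sub>0 'k"
  let ?M = "\<lambda>a j \<iota> \<kappa>. basis (insertion I a \<iota> (insertion J j \<kappa> K)) :: 'a set set \<Rightarrow>\<^sub>0 'k"
  have "(lcomp (lcomp (basis I) (basis J)) (basis K) :: 'a set set \<Rightarrow>\<^sub>0 'k) =
      (\<Sum>a\<in>I. \<Sum>\<iota>\<in>a \<rightarrow>\<^sub>E J. pcomp (insertion I a \<iota> J) K)"
    unfolding lcomp_basis pcomp_def[of I J] lcomp_sum_left ..
  also have "\<dots> = (\<Sum>a\<in>I. \<Sum>\<iota>\<in>a \<rightarrow>\<^sub>E J. (\<Sum>b\<in>I-{a}. \<Sum>\<kappa>\<in>b \<rightarrow>\<^sub>E K. ?D a b \<iota> \<kappa>) +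
      (\<Sum>j\<in>J. \<Sum>\<kappa>\<in>absorb a \<iota> j \<rightarrow>\<^sub>E K. ?N a j \<iota> \<kappa>))"
    by (intro sum.cong refl pcomp_insertion[OF fin I J IJ])
  also have "\<dots> = (\<Sum>a\<in>I. \<Sum>\<iota>\<in>a \<rightarrow>\<^sub>E J. \<Sum>b\<in>I-{a}. \<Sum>\<kappa>\<in>b \<rightarrow>\<^sub>E K. ?D a b \<iota> \<kappa>) +
      (\<Sum>a\<in>I. \<Sum>\<iota>\<in>a \<rightarrow>\<^sub>E J. \<Sum>j\<in>J. \<Sum>\<kappa>\<in>absorb a \<iota> j \<rightarrow>\<^sub>E K. ?N a j \<iota> \<kappa>)"
    by (simp only: sum.distrib)
  also have "(\<Sum>a\<in>I. \<Sum>\<iota>\<in>a \<rightarrow>\<^sub>E J. \<Sum>b\<in>I-{a}. \<Sum>\<kappa>\<in>b \<rightarrow>\<^sub>E K. ?D a b \<iota> \<kappa>) =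
      disjoint_insertions I J K"
    unfolding disjoint_insertions_def by (intro sum.cong refl sum.swap)
  also have "(\<Sum>a\<in>I. \<Sum>\<iota>\<in>a \<rightarrow>\<^sub>E J. \<Sum>j\<in>J. \<Sum>\<kappa>\<in>absorb a \<iota> j \<rightarrow>\<^sub>E K. ?N a j \<iota> \<kappa>) =
      (\<Sum>a\<in>I. \<Sum>j\<in>J. \<Sum>\<iota>\<in>a \<rightarrow>\<^sub>E J. \<Sum>\<kappa>\<in>absorb a \<iota> j \<rightarrow>\<^sub>E K. ?N a j \<iota> \<kappa>)"
    by (intro sum.cong refl sum.swap)
  also have "\<dots> = (\<Sum>a\<in>I. \<Sum>j\<in>J. \<Sum>\<kappa>\<in>j \<rightarrow>\<^sub>E K. \<Sum>\<iota>\<in>a \<rightarrow>\<^sub>E insertion J j \<kappa> K. ?M a j \<iota> \<kappa>)"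
    by (intro sum.cong refl sum_nested_insertion[OF fin I J K IJ JK])
  \<comment> \<open>The sums over \<open>j\<close> and \<kappa> come from \<open>pcomp J K\<close>
    and must stand outside the sum over \<open>a\<close>.\<close>
  also have "\<dots> = (\<Sum>j\<in>J. \<Sum>a\<in>I. \<Sum>\<kappa>\<in>j \<rightarrow>\<^sub>E K. \<Sum>\<iota>\<in>a \<rightarrow>\<^sub>E insertion J j \<kappa> K. ?M a j \<iota> \<kappa>)"
    by (rule sum.swap)
  also have "\<dots> = (\<Sum>j\<in>J. \<Sum>\<kappa>\<in>j \<rightarrow>\<^sub>E K. \<Sum>a\<in>I. \<Sum>\<iota>\<in>a \<rightarrow>\<^sub>E insertion J j \<kappa> K. ?M a j \<iota> \<kappa>)"
    by (intro sum.cong refl sum.swap)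
  also have "\<dots> = lcomp (basis I) (lcomp (basis J) (basis K))"
    unfolding lcomp_basis pcomp_def[of J K] lcomp_sum_right by (simp add: pcomp_def)
  finally show ?thesis by (simp add: add.commute)
qed

theorem theorem3p1:
  fixes A :: "'a set" and I J K :: "'a set set"
  assumes "finite A"
    and "I \<in> P2dis A" and "J \<in> P2dis A" and "K \<in> P2dis A"
    and "supp I \<inter> supp J = {}" and "supp J \<inter> supp K = {}" and "supp I \<inter> supp K = {}"
  shows "bracket (basis I) (bracket (basis J) (basis K))
       + bracket (basis K) (bracket (basis I) (basis J))
       + bracket (basis J) (bracket (basis K) (basis I))
       = (0 :: 'a set set \<Rightarrow>\<^sub>0 'k::field_char_0)"
proof -
  have disj: "supp J \<inter> supp I = {}" "supp K \<inter> supp J = {}" "supp K \<inter> supp I = {}"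
    using assms(5-7) by auto
  note assoc = lcomp_associator[where 'k = 'k, OF assms(1)]
  note fin = finite_P2dis(1)[OF assms(1)]
  \<comment> \<open>Each of the six left-nested compositions becomes a right-nested one plus a
    \<open>disjoint_insertions\<close> term. The right-nested ones cancel in pairs, and so do the
    other six terms once, for each first argument, the remaining two families are put in one
    order.\<close>
  show ?thesis
    unfolding bracket_def lcomp_diff_left lcomp_diff_right
    by (simp add: assoc assms disj disjoint_insertions_commute[OF fin[OF assms(2)], of K J]
        disjoint_insertions_commute[OF fin[OF assms(3)], of K I]
        disjoint_insertions_commute[OF fin[OF assms(4)], of J I])
qed

end
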